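(* Let $0<\epsilon\leq 1/4$ and $0<\alpha<\epsilon$. Set \[ E=(-1-\epsilon,-\epsilon)\cup(\epsilon,1+\epsilon)\subset\mathbb{R},\qquad I=(\alpha-\epsilon,\alpha), \] and let $f(x)=\chi_E(x)+\epsilon\chi_I(x)$ for $x\in\mathbb{R}$. Then, with \[ x_\epsilon=\frac{1+3\epsilon+\epsilon^3}{1+\epsilon^2}, \] we have for every $x\in\mathbb{R}$ \[ M_cf(x)= \begin{cases} \displaystyle 1-\frac{\epsilon-\epsilon^2/2}{1+\epsilon-|x|}, & |x|\leq\epsilon,\\[8pt] 1, & \epsilon<|x|<1+\epsilon,\\[4pt] \displaystyle \frac{1}{2(|x|-\epsilon)}, & 1+\epsilon\leq|x|\leq x_\epsilon,\\[8pt] \displaystyle \frac{2+\epsilon^2}{2(|x|+1+\epsilon)}, & |x|>x_\epsilon. \end{cases} \] In particular, $M_cf$ does not depend on $\alpha$.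
   Context: For $f\in L^1_{\mathrm{loc}}(\mathbb{R})$, the central Hardy--Littlewood maximal function is $M_cf(x)=\sup_{r>0}\frac{1}{2r}\int_{x-r}^{x+r}|f(t)|\,dt$. $\chi_A$ denotes the characteristic function of a set $A$. *)

theory Defs
  imports "HOL-Analysis.Analysis"
begin

(* Lebesgue integrals of |f| are taken in [0,\<infinity>] and the supremum in the extended reals, so no
   default value arises from a divergent integral or an unbounded set of averages. *)
definition central_maximal :: "(real \<Rightarrow> real) \<Rightarrow> real \<Rightarrow> ereal" where
  "central_maximal f x =
     (SUP r\<in>{0<..}. ereal (1 / (2 * r)) *
        enn2ereal (\<integral>\<^sup>+ t\<in>{x - r..x + r}. ennreal \<bar>f t\<bar> \<partial>lebesgue))"

definition set_E :: "real \<Rightarrow> real set" where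
  "set_E \<epsilon> = {- 1 - \<epsilon><..<- \<epsilon>} \<union> {\<epsilon><..<1 + \<epsilon>}"

definition set_I :: "real \<Rightarrow> real \<Rightarrow> real set" where
  "set_I \<epsilon> \<alpha> = {\<alpha> - \<epsilon><..<\<alpha>}"

definition fun_f :: "real \<Rightarrow> real \<Rightarrow> real \<Rightarrow> real" where
  "fun_f \<epsilon> \<alpha> x = indicator (set_E \<epsilon>) x + \<epsilon> * indicator (set_I \<epsilon> \<alpha>) x"

definition x_eps :: "real \<Rightarrow> real" where
  "x_eps \<epsilon> = (1 + 3 * \<epsilon> + \<epsilon> ^ 3) / (1 + \<epsilon>\<^sup>2)"

end

theory Submission imports Defs begin

text \<open>
  The average of \<open>f\<close> over \<open>[x - r, x + r]\<close> is governed by the mass that this interval captures from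
  three disjoint blocks: two plateaus of height \<open>1\<close> and length \<open>1\<close>, and, inside the gap
  \<open>(-\<epsilon>, \<epsilon>)\<close> between them, a bump of height \<open>\<epsilon>\<close> and length \<open>\<epsilon>\<close>. Lemma
  \<open>nn_integral_fun_f\<close> expresses this mass by lengths of overlaps, and
  \<open>central_maximal_fun_f_eqI\<close> reduces each value of the maximal function to a bound
  valid for all radii and one radius that attains it. Reflection at the origin replaces \<open>\<alpha>\<close> by
  \<open>\<epsilon> - \<alpha>\<close>, which has the same admissible range, so \<open>x \<ge> 0\<close> suffices.

  For \<open>x\<close> in the gap the best interval reaches exactly to the far end of the nearer plateau
  (\<open>r = 1 + \<epsilon> - x\<close>): it contains the whole gap, so the mass missing from height \<open>1\<close> is
  \<open>2\<epsilon> - \<epsilon>\<^sup>2\<close> wherever the bump sits. Smaller intervals either pay the same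
  deficit over a smaller length or are at least half inside the gap; larger ones gain mass on
  one side only, which pulls the average towards \<open>1/2\<close>. On the plateaus the supremum is \<open>1\<close>
  because \<open>0 \<le> f \<le> 1\<close>, and small intervals attain it.

  For \<open>x \<ge> 1 + \<epsilon>\<close> two radii compete: \<open>r = x - \<epsilon>\<close>, which captures the nearer plateau alone, and
  \<open>r = x + 1 + \<epsilon>\<close>, which captures everything. Lemma \<open>mass_outside_le\<close> shows that no other radius beats
  the better of the two, and the two averages agree precisely at \<open>x\<^sub>\<epsilon>\<close>. An interval that cuts the bump
  never matters, because the bump is low and short; hence its position does not enter.
\<close>

section \<open>The mass captured by an interval\<close>

definition overlap :: "real \<Rightarrow> real \<Rightarrow> real \<Rightarrow> real \<Rightarrow> real" where
  "overlap a b c d = max 0 (min b d - max a c)"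

definition mass :: "real \<Rightarrow> real \<Rightarrow> real \<Rightarrow> real \<Rightarrow> real" where
  "mass \<epsilon> \<alpha> x r =
     overlap (x - r) (x + r) (- 1 - \<epsilon>) (- \<epsilon>) + overlap (x - r) (x + r) \<epsilon> (1 + \<epsilon>)
     + \<epsilon> * overlap (x - r) (x + r) (\<alpha> - \<epsilon>) \<alpha>"

lemma overlap_nonneg: "0 \<le> overlap a b c d"
  by (simp add: overlap_def)

lemma emeasure_Icc_Int_Ioo:
  "emeasure lebesgue ({a..b} \<inter> {c<..<d}) = ennreal (overlap a b c d)"
proof (rule antisym)
  have "emeasure lebesgue ({a..b} \<inter> {c<..<d}) \<le> emeasure lebesgue {max a c..min b d}"
    by (rule emeasure_mono) auto
  also have "\<dots> = ennreal (overlap a b c d)"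
    by (auto simp: overlap_def max_def)
  finally show "emeasure lebesgue ({a..b} \<inter> {c<..<d}) \<le> ennreal (overlap a b c d)" .
  have "ennreal (overlap a b c d) = emeasure lebesgue {max a c<..<min b d}"
    by (auto simp: overlap_def max_def)
  also have "\<dots> \<le> emeasure lebesgue ({a..b} \<inter> {c<..<d})"
    by (rule emeasure_mono) auto
  finally show "ennreal (overlap a b c d) \<le> emeasure lebesgue ({a..b} \<inter> {c<..<d})" .
qed

lemma nn_integral_fun_f:
  assumes "0 < \<epsilon>"
  shows "(\<integral>\<^sup>+ t\<in>{x - r..x + r}. ennreal \<bar>fun_f \<epsilon> \<alpha> t\<bar> \<partial>lebesgue) = ennreal (mass \<epsilon> \<alpha> x r)"
proof -
  let ?J = "{x - r..x + r}"
  have meas: "indicator (?J \<inter> {c<..<d}) \<in> borel_measurable lebesgue" for c d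
    by (intro borel_measurable_indicator sets.Int) simp_all
  have int: "(\<integral>\<^sup>+ t. indicator (?J \<inter> {c<..<d}) t \<partial>lebesgue)
      = ennreal (overlap (x - r) (x + r) c d)" for c d
    by (subst nn_integral_indicator) (auto simp: emeasure_Icc_Int_Ioo)
  have "ennreal \<bar>fun_f \<epsilon> \<alpha> t\<bar> * indicator ?J t =
      indicator (?J \<inter> {- 1 - \<epsilon><..<- \<epsilon>}) t + indicator (?J \<inter> {\<epsilon><..<1 + \<epsilon>}) t
      + ennreal \<epsilon> * indicator (?J \<inter> {\<alpha> - \<epsilon><..<\<alpha>}) t" for t
    using assms
    by (auto simp: fun_f_def set_E_def set_I_def indicator_def ennreal_plus)
  then have "(\<integral>\<^sup>+ t\<in>?J. ennreal \<bar>fun_f \<epsilon> \<alpha> t\<bar> \<partial>lebesgue) =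
      (\<integral>\<^sup>+ t. indicator (?J \<inter> {- 1 - \<epsilon><..<- \<epsilon>}) t + indicator (?J \<inter> {\<epsilon><..<1 + \<epsilon>}) t
      + ennreal \<epsilon> * indicator (?J \<inter> {\<alpha> - \<epsilon><..<\<alpha>}) t \<partial>lebesgue)"
    by simp
  also have "\<dots> = ennreal (overlap (x - r) (x + r) (- 1 - \<epsilon>) (- \<epsilon>))
      + ennreal (overlap (x - r) (x + r) \<epsilon> (1 + \<epsilon>))
      + ennreal \<epsilon> * ennreal (overlap (x - r) (x + r) (\<alpha> - \<epsilon>) \<alpha>)"
    by (simp only: nn_integral_add nn_integral_cmult meas int borel_measurable_add
        borel_measurable_times_ennreal borel_measurable_const)
  also have "\<dots> = ennreal (mass \<epsilon> \<alpha> x r)"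
    using assms by (simp add: mass_def overlap_nonneg flip: ennreal_plus ennreal_mult)
  finally show ?thesis .
qed

lemma central_maximal_fun_f:
  assumes "0 < \<epsilon>"
  shows "central_maximal (fun_f \<epsilon> \<alpha>) x = (SUP r\<in>{0<..}. ereal (mass \<epsilon> \<alpha> x r / (2 * r)))"
proof -
  have "0 \<le> mass \<epsilon> \<alpha> x r" for r
    using assms by (simp add: mass_def overlap_nonneg)
  then show ?thesis
    using assms by (simp add: central_maximal_def nn_integral_fun_f)
qed

lemma central_maximal_fun_f_eqI:
  assumes "0 < \<epsilon>"
    and bound: "\<And>r. 0 < r \<Longrightarrow> mass \<epsilon> \<alpha> x r \<le> 2 * r * M"
    and "0 < \<rho>" and attained: "2 * \<rho> * M \<le> mass \<epsilon> \<alpha> x \<rho>"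
  shows "central_maximal (fun_f \<epsilon> \<alpha>) x = ereal M"
  unfolding central_maximal_fun_f[OF \<open>0 < \<epsilon>\<close>]
proof (rule antisym)
  show "(SUP r\<in>{0<..}. ereal (mass \<epsilon> \<alpha> x r / (2 * r))) \<le> ereal M"
    using bound by (intro SUP_least) (simp add: pos_divide_le_eq mult_ac)
  have "ereal M \<le> ereal (mass \<epsilon> \<alpha> x \<rho> / (2 * \<rho>))"
    using attained \<open>0 < \<rho>\<close> by (simp add: pos_le_divide_eq mult_ac)
  also have "\<dots> \<le> (SUP r\<in>{0<..}. ereal (mass \<epsilon> \<alpha> x r / (2 * r)))"
    using \<open>0 < \<rho>\<close> by (intro SUP_upper) simp
  finally show "ereal M \<le> (SUP r\<in>{0<..}. ereal (mass \<epsilon> \<alpha> x r / (2 * r)))" .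
qed

lemma overlap_uminus: "overlap a b c d = overlap (- b) (- a) (- d) (- c)"
  by (auto simp: overlap_def min_def max_def)

text \<open>
  The pair of plateaus is symmetric about the origin, and reflection moves the bump
  \<open>(\<alpha> - \<epsilon>, \<alpha>)\<close> to \<open>(-\<alpha>, \<epsilon> - \<alpha>)\<close>, which is again a bump of the same family.
\<close>

lemma mass_reflect: "mass \<epsilon> \<alpha> (- x) r = mass \<epsilon> (\<epsilon> - \<alpha>) x r"
  using overlap_uminus[of "x - r" "x + r" "- 1 - \<epsilon>" "- \<epsilon>"]
    overlap_uminus[of "x - r" "x + r" \<epsilon> "1 + \<epsilon>"]
    overlap_uminus[of "x - r" "x + r" "- \<alpha>" "\<epsilon> - \<alpha>"]
  by (simp add: mass_def minus_diff_commute add_ac)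

lemma central_maximal_reflect:
  assumes "0 < \<epsilon>"
  shows "central_maximal (fun_f \<epsilon> \<alpha>) (- x) = central_maximal (fun_f \<epsilon> (\<epsilon> - \<alpha>)) x"
  using assms by (simp add: central_maximal_fun_f mass_reflect)

lemma overlap_le:
  assumes "0 \<le> v" and "min b d - max a c \<le> v"
  shows "overlap a b c d \<le> v"
  using assms by (simp add: overlap_def)

lemma overlap_bump_le: "overlap a b (\<alpha> - \<epsilon>) \<alpha> \<le> \<epsilon>" if "0 < \<epsilon>"
  using that by (intro overlap_le) auto

section \<open>Points in the gap between the plateaus\<close>

text \<open>
  Three regimes of the radius. Below \<open>\<epsilon> + x\<close> at most the right half of the interval meets a plateau,
  so the average is at most \<open>(1 + \<epsilon>)/2\<close>. Between \<open>\<epsilon> + x\<close> and the optimal \<open>1 + \<epsilon> - x\<close> the missing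
  mass is at least the constant \<open>2\<epsilon> - \<epsilon>\<^sup>2\<close>. Beyond that only the left end can still gain mass.
\<close>

lemma mass_gap_le:
  fixes \<epsilon> :: real
  assumes e: "0 < \<epsilon>" "\<epsilon> \<le> 1 / 4" and a: "0 < \<alpha>" "\<alpha> < \<epsilon>" and x: "0 \<le> x" "x \<le> \<epsilon>" and r: "0 < r"
  shows "mass \<epsilon> \<alpha> x r \<le> 2 * r * (1 - (\<epsilon> - \<epsilon>\<^sup>2 / 2) / (1 + \<epsilon> - x))"
proof -
  define K where "K = 1 + \<epsilon> - x"
  define c where "c = \<epsilon> - \<epsilon>\<^sup>2 / 2"
  define O1 where "O1 = overlap (x - r) (x + r) (- 1 - \<epsilon>) (- \<epsilon>)"
  define O2 where "O2 = overlap (x - r) (x + r) \<epsilon> (1 + \<epsilon>)"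
  define O3 where "O3 = overlap (x - r) (x + r) (\<alpha> - \<epsilon>) \<alpha>"
  have m: "mass \<epsilon> \<alpha> x r = O1 + O2 + \<epsilon> * O3"
    by (simp add: mass_def O1_def O2_def O3_def)
  have K: "1 \<le> K" using x by (simp add: K_def)
  have c0: "0 < c"
    using e by (simp add: c_def power2_eq_square)
  have "0 \<le> (1 - 3 * \<epsilon>) + \<epsilon>\<^sup>2"
    using e by (intro add_nonneg_nonneg) auto
  then have c1: "2 * c \<le> 1 - \<epsilon>"
    by (simp add: c_def right_diff_distrib)
  have "1 - \<epsilon> \<le> (1 - \<epsilon>) * K"
    using mult_left_mono[of 1 K "1 - \<epsilon>"] K e by simp
  with c1 have "2 * c \<le> (1 - \<epsilon>) * K"
    by (rule order_trans)
  have O3: "\<epsilon> * O3 \<le> \<epsilon>\<^sup>2"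
    using overlap_bump_le[of \<epsilon>] e by (simp add: O3_def power2_eq_square)
  consider "r \<le> \<epsilon> + x" | "\<epsilon> + x \<le> r" "r \<le> K" | "K \<le> r" by linarith
  then have "mass \<epsilon> \<alpha> x r * K \<le> 2 * r * (K - c)"
  proof cases
    case 1
    have "O1 = 0"
      using 1 by (auto simp: O1_def overlap_def)
    moreover have O2: "O2 \<le> r"
      using x r e unfolding O2_def by (intro overlap_le) auto
    moreover have "O2 + O3 \<le> 2 * r"
      using a x r e by (auto simp: O2_def O3_def overlap_def min_def max_def)
    then have "\<epsilon> * O3 \<le> \<epsilon> * (2 * r - O2)"
      using e by (intro mult_left_mono) auto
    moreover have "(1 - \<epsilon>) * O2 \<le> (1 - \<epsilon>) * r"
      using O2 e by (intro mult_left_mono) auto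
    \<comment> \<open>The worst case: height \<open>1\<close> on the right half of the interval, \<open>\<epsilon>\<close> on the left half.\<close>
    ultimately have "mass \<epsilon> \<alpha> x r \<le> r * (1 + \<epsilon>)"
      unfolding m by (simp add: algebra_simps)
    then have "mass \<epsilon> \<alpha> x r * K \<le> r * (1 + \<epsilon>) * K"
      using K by (intro mult_right_mono) auto
    also have "\<dots> = r * (2 * K - (1 - \<epsilon>) * K)"
      by (simp add: algebra_simps)
    also have "\<dots> \<le> r * (2 * K - 2 * c)"
      using \<open>2 * c \<le> (1 - \<epsilon>) * K\<close> r by (intro mult_left_mono) auto
    finally show ?thesis by (simp add: algebra_simps)
  next
    case 2
    have "O1 + O2 \<le> 2 * r - 2 * \<epsilon>"
      using 2 x e by (auto simp: O1_def O2_def overlap_def K_def)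
    then have "mass \<epsilon> \<alpha> x r \<le> 2 * r - 2 * c"
      using O3 unfolding m c_def by simp
    then have "mass \<epsilon> \<alpha> x r * K \<le> (2 * r - 2 * c) * K"
      using K by (intro mult_right_mono) auto
    also have "\<dots> \<le> 2 * r * (K - c)"
      using mult_left_mono[OF \<open>r \<le> K\<close>, of c] c0 by (simp add: algebra_simps)
    finally show ?thesis .
  next
    case 3
    have "O1 \<le> r - x - \<epsilon>" "O2 \<le> 1"
      using 3 x e by (auto simp: O1_def O2_def overlap_def K_def)
    then have "mass \<epsilon> \<alpha> x r \<le> r + K - 2 * c"
      using O3 unfolding m c_def K_def by simp
    then have "mass \<epsilon> \<alpha> x r * K \<le> (r + K - 2 * c) * K"
      using K by (intro mult_right_mono) auto
    also have "\<dots> \<le> 2 * r * (K - c)"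
      using mult_right_mono[OF \<open>K \<le> r\<close>, of "K - 2 * c"] c1 K e by (simp add: algebra_simps)
    finally show ?thesis .
  qed
  then have "mass \<epsilon> \<alpha> x r \<le> 2 * r * (K - c) / K"
    using K by (simp add: pos_le_divide_eq)
  also have "\<dots> = 2 * r * (1 - c / K)"
    using K by (simp add: field_simps)
  finally show ?thesis by (simp add: c_def K_def)
qed

lemma central_maximal_gap:
  fixes \<epsilon> :: real
  assumes e: "0 < \<epsilon>" "\<epsilon> \<le> 1 / 4" and a: "0 < \<alpha>" "\<alpha> < \<epsilon>" and x: "0 \<le> x" "x \<le> \<epsilon>"
  shows "central_maximal (fun_f \<epsilon> \<alpha>) x = ereal (1 - (\<epsilon> - \<epsilon>\<^sup>2 / 2) / (1 + \<epsilon> - x))"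
proof (rule central_maximal_fun_f_eqI)
  show "2 * (1 + \<epsilon> - x) * (1 - (\<epsilon> - \<epsilon>\<^sup>2 / 2) / (1 + \<epsilon> - x)) \<le> mass \<epsilon> \<alpha> x (1 + \<epsilon> - x)"
  proof -
    have "2 * (1 + \<epsilon> - x) * (1 - (\<epsilon> - \<epsilon>\<^sup>2 / 2) / (1 + \<epsilon> - x)) = 2 - 2 * x + \<epsilon>\<^sup>2"
      using x by (simp add: field_simps)
    also have "\<dots> = mass \<epsilon> \<alpha> x (1 + \<epsilon> - x)"
      using x e a by (simp add: mass_def overlap_def power2_eq_square)
    finally show ?thesis by simp
  qed
qed (use assms mass_gap_le in auto)

section \<open>Points on a plateau\<close>

text \<open>The blocks are disjoint and no higher than \<open>1\<close>, so averages never exceed \<open>1\<close>.\<close>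

lemma mass_le_length:
  assumes e: "0 < \<epsilon>" "\<epsilon> \<le> 1 / 4" and a: "0 < \<alpha>" "\<alpha> < \<epsilon>" and r: "0 < r"
  shows "mass \<epsilon> \<alpha> x r \<le> 2 * r"
proof -
  define O3 where "O3 = overlap (x - r) (x + r) (\<alpha> - \<epsilon>) \<alpha>"
  have "\<epsilon> * O3 \<le> O3"
    using e by (intro mult_left_le_one_le) (auto simp: O3_def overlap_nonneg)
  moreover have "overlap (x - r) (x + r) (- 1 - \<epsilon>) (- \<epsilon>) + overlap (x - r) (x + r) \<epsilon> (1 + \<epsilon>) + O3
      \<le> 2 * r"
    using e a r by (auto simp: O3_def overlap_def min_def max_def)
  ultimately show ?thesis
    by (simp add: mass_def O3_def)
qed

lemma central_maximal_plateau:
  assumes e: "0 < \<epsilon>" "\<epsilon> \<le> 1 / 4" and a: "0 < \<alpha>" "\<alpha> < \<epsilon>" and x: "\<epsilon> < x" "x < 1 + \<epsilon>"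
  shows "central_maximal (fun_f \<epsilon> \<alpha>) x = ereal 1"
proof (rule central_maximal_fun_f_eqI)
  define \<rho> where "\<rho> = min (x - \<epsilon>) (1 + \<epsilon> - x)"
  show "0 < \<rho>" using x by (simp add: \<rho>_def)
  have "overlap (x - \<rho>) (x + \<rho>) \<epsilon> (1 + \<epsilon>) = 2 * \<rho>"
    using x by (auto simp: overlap_def \<rho>_def)
  then show "2 * \<rho> * 1 \<le> mass \<epsilon> \<alpha> x \<rho>"
    using e by (simp add: mass_def overlap_nonneg)
qed (use assms mass_le_length in auto)

section \<open>Points outside the plateaus\<close>

text \<open>
  With \<open>u = x - \<epsilon>\<close> and \<open>V = x + 1 + \<epsilon>\<close> the two candidates are \<open>r = u\<close> and \<open>r = V\<close>. While the
  left end of the interval crosses a plateau, the mass grows at rate \<open>1\<close>, which is at least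
  \<open>mass / r\<close>, so \<open>mass / r\<close> does not decrease; hence only radii \<open>r \<in> [u, x + \<epsilon>]\<close>, for which that end lies in the gap, need care. There the
  bump contributes at most \<open>\<epsilon> (r - u)\<close> and at most \<open>\<epsilon>\<^sup>2\<close>. If \<open>\<epsilon> u \<le> 1\<close>, the first bound makes
  \<open>r = u\<close> better; otherwise \<open>u > 4\<close>, and the second bound makes \<open>r = V\<close> better.
\<close>

lemma mass_outside_le:
  fixes \<epsilon> :: real
  assumes e: "0 < \<epsilon>" "\<epsilon> \<le> 1 / 4" and a: "0 < \<alpha>" "\<alpha> < \<epsilon>" and x: "1 + \<epsilon> \<le> x" and r: "0 < r"
  shows "mass \<epsilon> \<alpha> x r \<le> r * max (1 / (x - \<epsilon>)) ((2 + \<epsilon>\<^sup>2) / (x + 1 + \<epsilon>))"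
proof -
  define u where "u = x - \<epsilon>"
  define V where "V = x + 1 + \<epsilon>"
  define m where "m = 2 + \<epsilon>\<^sup>2"
  define O1 where "O1 = overlap (x - r) (x + r) (- 1 - \<epsilon>) (- \<epsilon>)"
  define O2 where "O2 = overlap (x - r) (x + r) \<epsilon> (1 + \<epsilon>)"
  define O3 where "O3 = overlap (x - r) (x + r) (\<alpha> - \<epsilon>) \<alpha>"
  have mass: "mass \<epsilon> \<alpha> x r = O1 + O2 + \<epsilon> * O3"
    by (simp add: mass_def O1_def O2_def O3_def)
  have u: "1 \<le> u" using x by (simp add: u_def)
  have e2: "\<epsilon>\<^sup>2 \<le> \<epsilon> / 4"
    using mult_left_mono[OF e(2), of \<epsilon>] e by (simp add: power2_eq_square)
  have V: "m \<le> V" "0 < V" using e2 x e by (auto simp: m_def V_def)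
  have O3: "\<epsilon> * O3 \<le> \<epsilon>\<^sup>2"
    using overlap_bump_le[of \<epsilon>] e by (simp add: O3_def power2_eq_square)
  have "mass \<epsilon> \<alpha> x r * u \<le> r \<or> mass \<epsilon> \<alpha> x r * V \<le> r * m"
  proof -
    consider (near) "r \<le> u" | (gap) "u \<le> r" "r \<le> x + \<epsilon>" | (far) "x + \<epsilon> \<le> r" "r \<le> V" | (all) "V \<le> r"
      by linarith
    then show ?thesis
    proof cases
      case near
      have "O1 = 0" "O3 = 0"
        using near e a by (auto simp: O1_def O3_def overlap_def u_def)
      moreover have "O2 \<le> max 0 (r - u + 1)"
        using near e x by (auto simp: O2_def overlap_def u_def)
      ultimately have "mass \<epsilon> \<alpha> x r * u \<le> max 0 (r - u + 1) * u"
        unfolding mass using u by (intro mult_right_mono) auto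
      also have "\<dots> \<le> r"
      proof (cases "r - u + 1 \<le> 0")
        case False
        have "0 \<le> (u - r) * (u - 1)"
          using near u by (intro mult_nonneg_nonneg) auto
        then show ?thesis
          using False by (simp add: algebra_simps)
      qed (use r in auto)
      finally show ?thesis by simp
    next
      case gap
      have O1: "O1 = 0"
        using gap by (auto simp: O1_def overlap_def)
      have O2: "O2 \<le> 1"
        using e unfolding O2_def by (intro overlap_le) auto
      show ?thesis
      proof (cases "\<epsilon> * u \<le> 1")
        case True
        have "O3 \<le> r - u"
          using gap a e x unfolding O3_def u_def by (intro overlap_le) auto
        then have "mass \<epsilon> \<alpha> x r \<le> 1 + \<epsilon> * (r - u)"
          using O1 O2 e unfolding mass by (simp add: add_mono)
        then have "mass \<epsilon> \<alpha> x r * u \<le> (1 + \<epsilon> * (r - u)) * u"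
          using u by (intro mult_right_mono) auto
        also have "\<dots> = u + (\<epsilon> * u) * (r - u)"
          by (simp add: algebra_simps)
        also have "\<dots> \<le> u + 1 * (r - u)"
          using True gap by (intro add_left_mono mult_right_mono) auto
        finally show ?thesis by simp
      next
        case False
        have "\<epsilon> * u \<le> 1 / 4 * u"
          using e u by (intro mult_right_mono) auto
        then have "4 < u" using False by linarith
        have "mass \<epsilon> \<alpha> x r * V \<le> (1 + \<epsilon>\<^sup>2) * V"
          using O1 O2 O3 V unfolding mass by (intro mult_right_mono) auto
        also have "\<dots> = u + \<epsilon>\<^sup>2 * u + (1 + \<epsilon>\<^sup>2) * (1 + 2 * \<epsilon>)"
          by (simp add: V_def u_def algebra_simps)
        also have "(1 + \<epsilon>\<^sup>2) * (1 + 2 * \<epsilon>) \<le> 2 * 2"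
          using e e2 by (intro mult_mono) auto
        also have "u + \<epsilon>\<^sup>2 * u + 2 * 2 \<le> u * m"
          using \<open>4 < u\<close> by (simp add: m_def algebra_simps)
        also have "\<dots> \<le> r * m"
          using gap by (intro mult_right_mono) (auto simp: m_def)
        finally show ?thesis by simp
      qed
    next
      case far
      have "O1 \<le> r - x - \<epsilon>" "O2 \<le> 1"
        using far e x by (auto simp: O1_def O2_def overlap_def)
      then have "mass \<epsilon> \<alpha> x r \<le> r + m - V"
        using O3 unfolding mass m_def V_def by simp
      then have "mass \<epsilon> \<alpha> x r * V \<le> (r + m - V) * V"
        using V by (intro mult_right_mono) auto
      also have "\<dots> \<le> r * m"
      proof -
        have "0 \<le> (V - r) * (V - m)"
          using far V by (intro mult_nonneg_nonneg) auto
        then show ?thesis by (simp add: algebra_simps)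
      qed
      finally show ?thesis by simp
    next
      case all
      have "O1 \<le> 1" "O2 \<le> 1"
        using e unfolding O1_def O2_def by (auto intro!: overlap_le)
      then have "mass \<epsilon> \<alpha> x r \<le> m"
        using O3 unfolding mass m_def by simp
      then have "mass \<epsilon> \<alpha> x r * V \<le> m * r"
        using all V by (intro mult_mono) (auto simp: m_def)
      then show ?thesis by (simp add: mult.commute)
    qed
  qed
  then have "mass \<epsilon> \<alpha> x r \<le> r * (1 / u) \<or> mass \<epsilon> \<alpha> x r \<le> r * (m / V)"
    using u V by (simp add: pos_le_divide_eq)
  moreover have "r * (1 / u) \<le> r * max (1 / u) (m / V)" "r * (m / V) \<le> r * max (1 / u) (m / V)"
    using r by (intro mult_left_mono; simp)+
  ultimately show ?thesis
    unfolding u_def V_def m_def by linarith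
qed

lemma central_maximal_outside:
  fixes \<epsilon> :: real
  assumes e: "0 < \<epsilon>" "\<epsilon> \<le> 1 / 4" and a: "0 < \<alpha>" "\<alpha> < \<epsilon>" and x: "1 + \<epsilon> \<le> x"
  shows "central_maximal (fun_f \<epsilon> \<alpha>) x =
    ereal (max (1 / (x - \<epsilon>)) ((2 + \<epsilon>\<^sup>2) / (x + 1 + \<epsilon>)) / 2)"
proof -
  let ?M = "max (1 / (x - \<epsilon>)) ((2 + \<epsilon>\<^sup>2) / (x + 1 + \<epsilon>))"
  define \<rho> where "\<rho> = (if ?M = 1 / (x - \<epsilon>) then x - \<epsilon> else x + 1 + \<epsilon>)"
  have "overlap (x - (x - \<epsilon>)) (x + (x - \<epsilon>)) \<epsilon> (1 + \<epsilon>) = 1"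
    using e x by (simp add: overlap_def)
  then have plateau: "1 \<le> mass \<epsilon> \<alpha> x (x - \<epsilon>)"
    using e by (simp add: mass_def overlap_nonneg)
  have total: "mass \<epsilon> \<alpha> x (x + 1 + \<epsilon>) = 2 + \<epsilon>\<^sup>2"
    using e a x by (simp add: mass_def overlap_def power2_eq_square)
  have cancel: "2 * V * (m / V / 2) = m" if "V \<noteq> 0" for V m :: real
    using that by simp
  show ?thesis
  proof (rule central_maximal_fun_f_eqI)
    show "0 < \<rho>" using x e by (simp add: \<rho>_def)
    show "2 * \<rho> * (?M / 2) \<le> mass \<epsilon> \<alpha> x \<rho>"
    proof (cases "?M = 1 / (x - \<epsilon>)")
      case True
      then have "\<rho> = x - \<epsilon>" by (simp add: \<rho>_def)
      moreover have "2 * (x - \<epsilon>) * (1 / (x - \<epsilon>) / 2) = 1"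
        using x by (intro cancel) simp
      ultimately show ?thesis
        unfolding True using plateau by (simp only:)
    next
      case False
      then have M: "?M = (2 + \<epsilon>\<^sup>2) / (x + 1 + \<epsilon>)" by linarith
      have "\<rho> = x + 1 + \<epsilon>" using False unfolding \<rho>_def by (simp only: if_False)
      moreover have "x + 1 + \<epsilon> \<noteq> 0" using x e by linarith
      then have "2 * (x + 1 + \<epsilon>) * ((2 + \<epsilon>\<^sup>2) / (x + 1 + \<epsilon>) / 2) = 2 + \<epsilon>\<^sup>2"
        by (rule cancel)
      ultimately show ?thesis
        unfolding M using total by (simp only:)
    qed
    show "mass \<epsilon> \<alpha> x r \<le> 2 * r * (?M / 2)" if "0 < r" for r
      using mass_outside_le[OF e a x that] by simp
  qed (rule e)
qed

text \<open>
  The point \<open>x\<^sub>\<epsilon>\<close> is where the two candidate averages cross: clearing denominators turns their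
  comparison into the linear inequality \<open>x (1 + \<epsilon>\<^sup>2) \<le> 1 + 3\<epsilon> + \<epsilon>\<^sup>3\<close>.
\<close>

lemma outside_candidates_le_iff:
  fixes \<epsilon> :: real
  assumes e: "0 < \<epsilon>" and x: "1 + \<epsilon> \<le> x"
  shows "(2 + \<epsilon>\<^sup>2) / (x + 1 + \<epsilon>) \<le> 1 / (x - \<epsilon>) \<longleftrightarrow> x \<le> x_eps \<epsilon>"
proof -
  have pos: "0 < x + 1 + \<epsilon>" "0 < x - \<epsilon>" "0 < 1 + \<epsilon>\<^sup>2"
    using assms by (auto intro: add_pos_nonneg)
  have "(2 + \<epsilon>\<^sup>2) / (x + 1 + \<epsilon>) \<le> 1 / (x - \<epsilon>) \<longleftrightarrow> (2 + \<epsilon>\<^sup>2) * (x - \<epsilon>) \<le> x + 1 + \<epsilon>"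
    using pos by (simp add: divide_le_eq le_divide_eq)
  also have "\<dots> \<longleftrightarrow> x * (1 + \<epsilon>\<^sup>2) \<le> 1 + 3 * \<epsilon> + \<epsilon> ^ 3"
    by (simp add: algebra_simps power2_eq_square power3_eq_cube)
  also have "\<dots> \<longleftrightarrow> x \<le> x_eps \<epsilon>"
    using pos by (simp add: x_eps_def pos_le_divide_eq)
  finally show ?thesis .
qed

lemma x_eps_ge:
  fixes \<epsilon> :: real
  assumes "0 < \<epsilon>" "\<epsilon> \<le> 1 / 4"
  shows "1 + \<epsilon> \<le> x_eps \<epsilon>"
proof -
  have "\<epsilon> * \<epsilon> \<le> \<epsilon>"
    using assms by (intro mult_left_le) auto
  then have "(1 + \<epsilon>) * (1 + \<epsilon>\<^sup>2) \<le> 1 + 3 * \<epsilon> + \<epsilon> ^ 3"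
    using assms by (simp add: algebra_simps power2_eq_square power3_eq_cube)
  then show ?thesis
    by (simp add: x_eps_def pos_le_divide_eq add_pos_nonneg)
qed

section \<open>The maximal function\<close>

definition maximal_value :: "real \<Rightarrow> real \<Rightarrow> real" where
  "maximal_value \<epsilon> y =
     (if y \<le> \<epsilon> then 1 - (\<epsilon> - \<epsilon>\<^sup>2 / 2) / (1 + \<epsilon> - y)
      else if y < 1 + \<epsilon> then 1
      else if y \<le> x_eps \<epsilon> then 1 / (2 * (y - \<epsilon>))
      else (2 + \<epsilon>\<^sup>2) / (2 * (y + 1 + \<epsilon>)))"

lemma central_maximal_nonneg:
  assumes e: "0 < \<epsilon>" "\<epsilon> \<le> 1 / 4" and a: "0 < \<alpha>" "\<alpha> < \<epsilon>" and x: "0 \<le> x"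
  shows "central_maximal (fun_f \<epsilon> \<alpha>) x = ereal (maximal_value \<epsilon> x)"
proof -
  consider "x \<le> \<epsilon>" | "\<epsilon> < x" "x < 1 + \<epsilon>" | "1 + \<epsilon> \<le> x"
    by linarith
  then show ?thesis
  proof cases
    case 1
    then show ?thesis
      using central_maximal_gap[OF e a x] by (simp add: maximal_value_def)
  next
    case 2
    then show ?thesis
      using central_maximal_plateau[OF e a] by (simp add: maximal_value_def)
  next
    case 3
    have "max (1 / (x - \<epsilon>)) ((2 + \<epsilon>\<^sup>2) / (x + 1 + \<epsilon>)) / 2 = maximal_value \<epsilon> x"
    proof (cases "x \<le> x_eps \<epsilon>")
      case True
      then show ?thesis
        using 3 outside_candidates_le_iff[OF e(1) 3]
        by (simp add: maximal_value_def max_absorb1)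
    next
      case False
      then have "1 / (x - \<epsilon>) \<le> (2 + \<epsilon>\<^sup>2) / (x + 1 + \<epsilon>)"
        using outside_candidates_le_iff[OF e(1) 3] by linarith
      then show ?thesis
        using 3 False by (simp add: maximal_value_def max_absorb2 mult.commute)
    qed
    then show ?thesis
      using central_maximal_outside[OF e a 3] by simp
  qed
qed

lemma central_maximal_fun_f_value:
  assumes e: "0 < \<epsilon>" "\<epsilon> \<le> 1 / 4" and a: "0 < \<alpha>" "\<alpha> < \<epsilon>"
  shows "central_maximal (fun_f \<epsilon> \<alpha>) x = ereal (maximal_value \<epsilon> \<bar>x\<bar>)"
proof (cases "0 \<le> x")
  case True
  then show ?thesis
    using central_maximal_nonneg[OF e a] by simp
next
  case False
  have "central_maximal (fun_f \<epsilon> \<alpha>) x = central_maximal (fun_f \<epsilon> (\<epsilon> - \<alpha>)) (- x)"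
    using central_maximal_reflect[OF e(1), of \<alpha> "- x"] by simp
  then show ?thesis
    using central_maximal_nonneg[OF e, of "\<epsilon> - \<alpha>" "- x"] a False by simp
qed

theorem theorem1:
  fixes \<epsilon> \<alpha> :: real
  assumes "0 < \<epsilon>" and "\<epsilon> \<le> 1 / 4" and "0 < \<alpha>" and "\<alpha> < \<epsilon>"
  shows "(\<forall>x :: real.
            (\<bar>x\<bar> \<le> \<epsilon> \<longrightarrow>
               central_maximal (fun_f \<epsilon> \<alpha>) x = ereal (1 - (\<epsilon> - \<epsilon>\<^sup>2 / 2) / (1 + \<epsilon> - \<bar>x\<bar>))) \<and>
            (\<epsilon> < \<bar>x\<bar> \<and> \<bar>x\<bar> < 1 + \<epsilon> \<longrightarrow>
               central_maximal (fun_f \<epsilon> \<alpha>) x = ereal 1) \<and>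
            (1 + \<epsilon> \<le> \<bar>x\<bar> \<and> \<bar>x\<bar> \<le> x_eps \<epsilon> \<longrightarrow>
               central_maximal (fun_f \<epsilon> \<alpha>) x = ereal (1 / (2 * (\<bar>x\<bar> - \<epsilon>)))) \<and>
            (\<bar>x\<bar> > x_eps \<epsilon> \<longrightarrow>
               central_maximal (fun_f \<epsilon> \<alpha>) x = ereal ((2 + \<epsilon>\<^sup>2) / (2 * (\<bar>x\<bar> + 1 + \<epsilon>))))) \<and>
         (\<forall>\<beta> :: real. 0 < \<beta> \<and> \<beta> < \<epsilon> \<longrightarrow>
            central_maximal (fun_f \<epsilon> \<beta>) = central_maximal (fun_f \<epsilon> \<alpha>))"
proof (intro conjI allI impI)
  note Mc = central_maximal_fun_f_value[OF assms]
  fix x :: real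
  show "central_maximal (fun_f \<epsilon> \<alpha>) x = ereal (1 - (\<epsilon> - \<epsilon>\<^sup>2 / 2) / (1 + \<epsilon> - \<bar>x\<bar>))"
    if "\<bar>x\<bar> \<le> \<epsilon>"
    using that by (simp add: Mc maximal_value_def)
  show "central_maximal (fun_f \<epsilon> \<alpha>) x = ereal 1" if "\<epsilon> < \<bar>x\<bar> \<and> \<bar>x\<bar> < 1 + \<epsilon>"
    using that by (simp add: Mc maximal_value_def)
  show "central_maximal (fun_f \<epsilon> \<alpha>) x = ereal (1 / (2 * (\<bar>x\<bar> - \<epsilon>)))"
    if "1 + \<epsilon> \<le> \<bar>x\<bar> \<and> \<bar>x\<bar> \<le> x_eps \<epsilon>"
    using that by (simp add: Mc maximal_value_def)
  show "central_maximal (fun_f \<epsilon> \<alpha>) x = ereal ((2 + \<epsilon>\<^sup>2) / (2 * (\<bar>x\<bar> + 1 + \<epsilon>)))"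
    if "x_eps \<epsilon> < \<bar>x\<bar>"
    using that x_eps_ge[OF assms(1,2)] assms(1) by (simp add: Mc maximal_value_def)
next
  fix \<beta> :: real
  assume "0 < \<beta> \<and> \<beta> < \<epsilon>"
  then show "central_maximal (fun_f \<epsilon> \<beta>) = central_maximal (fun_f \<epsilon> \<alpha>)"
    using assms by (simp add: fun_eq_iff central_maximal_fun_f_value)
qed

end
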